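(* Let $p\ge q\ge1$ be integers and let $k$ be a positive integer. There exist real coefficients $\alpha_0$ and $\alpha_s$ (for $s\in\mathcal S[l]$, $1\le l\le k-1$), depending only on $p$ and $q$ (for the given $k$), such that $$U_k=\mathrm{tr}[(\mathbf Y^T\mathbf Y)^k]+\alpha_0+\sum_{l=1}^{k-1}\ \sum_{s\in\mathcal S[l]}\alpha_s\prod_{i=1}^{|s|}\mathrm{tr}[(\mathbf Y^T\mathbf Y)^{s_i}].$$
   Context: $\mathbf Y$ is a real $p\times q$ matrix (the observation $\mathbf Y=\mathbf A+\mathbf E$, with $\mathbf A$ deterministic and $\mathbf E$ having independent standard normal entries). Hermite polynomials: with $\phi(y)=e^{-y^2/2}(2\pi)^{-1/2}$, $H_r$ is the degree-$r$ polynomial defined by $\frac{d^r}{dy^r}\phi(y)=(-1)^rH_r(y)\phi(y)$ ($H_0=1$). For sequences $i=(i_1,\dots,i_k)\in\{1,\dots,p\}^k$ and $j=(j_1,\dots,j_k)\in\{1,\dots,q\}^k$, with the convention $j_{k+1}=j_1$, $N_{rs}(i,j)$ denotes the number of occurrences of the pair $(r,s)$ among the $2k$ pairs $(i_t,j_t)$ and $(i_t,j_{t+1})$, $t=1,\dots,k$. Then $$U_k=\sum_{i_1,\dots,i_k=1}^p\ \sum_{j_1,\dots,j_k=1}^q\ \prod_{r=1}^p\prod_{s=1}^qH_{N_{rs}(i,j)}(\mathbf Y_{rs}).$$ For a positive integer $l$, $\mathcal S[l]$ is the collection of nondecreasing finite sequences $s=(s_1,\dots,s_{|s|})$ of positive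 integers, $1\le s_1\le s_2\le\cdots\le s_{|s|}$, with $\sum_i s_i=l$; $|s|$ is the length of $s$. *)

theory Defs
  imports
    "HOL-Probability.Distributions"
    "HOL-Computational_Algebra.Polynomial"
    "Jordan_Normal_Form.Matrix"
begin

(* std_normal_density is the library's (2 pi)^(-1/2) exp (- y^2 / 2). *)
definition hermite :: "nat \<Rightarrow> real poly" where
  "hermite r = (THE H. degree H = r \<and>
     (\<forall>y. (deriv ^^ r) std_normal_density y = (-1) ^ r * poly H y * std_normal_density y))"

lemma deriv_std_normal_density_poly:
  "((\<lambda>y. c * poly H y * std_normal_density y) has_field_derivative
      c * poly (pderiv H - [:0, 1:] * H) y * std_normal_density y) (at y)"
proof -
  have "(std_normal_density has_field_derivative K * (exp (- y\<^sup>2 / 2) * (- y))) (at y)"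
    if "K = 1 / sqrt (2 * pi)" for K
    unfolding std_normal_density_def that[symmetric]
    by (auto intro!: derivative_eq_intros)
  then have "(std_normal_density has_field_derivative - y * std_normal_density y) (at y)"
    by (simp add: std_normal_density_def mult_ac)
  then show ?thesis
    by (auto intro!: derivative_eq_intros simp: poly_DERIV algebra_simps)
qed

lemma ex1_hermite:
  "\<exists>!H. degree H = r \<and>
     (\<forall>y. (deriv ^^ r) std_normal_density y = (-1) ^ r * poly H y * std_normal_density y)"
proof -
  let ?D = "\<lambda>r H. \<forall>y. (deriv ^^ r) std_normal_density y = (-1) ^ r * poly H y * std_normal_density y"
  have "\<exists>H. degree H = r \<and> H \<noteq> 0 \<and> ?D r H"
  proof (induction r)
    case 0
    show ?case by (rule exI[of _ 1]) simp
  next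
    case (Suc r)
    then obtain H where H: "degree H = r" "H \<noteq> 0" "?D r H" by blast
    define G where "G = [:0, 1:] * H - pderiv H"
    have dl: "degree ([:0, 1:] * H) = Suc r"
      using H by (simp add: degree_mult_eq)
    have dr: "degree (- pderiv H) < Suc r"
      using H by (simp add: degree_pderiv)
    have dG: "degree G = Suc r"
      using degree_add_eq_left[of "- pderiv H" "[:0, 1:] * H"] dl dr by (simp add: G_def)
    have eq: "(deriv ^^ r) std_normal_density = (\<lambda>y. (-1) ^ r * poly H y * std_normal_density y)"
      using H by auto
    have "?D (Suc r) G"
    proof
      fix y
      have "(deriv ^^ Suc r) std_normal_density y
              = (-1) ^ r * poly (pderiv H - [:0, 1:] * H) y * std_normal_density y"
        using DERIV_imp_deriv[OF deriv_std_normal_density_poly[of "(-1) ^ r" H y]] by (simp add: eq)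
      also have "\<dots> = (-1) ^ Suc r * poly G y * std_normal_density y"
        by (simp add: G_def algebra_simps)
      finally show "(deriv ^^ Suc r) std_normal_density y = (-1) ^ Suc r * poly G y * std_normal_density y" .
    qed
    with dG show ?case by (intro exI[of _ G]) auto
  qed
  moreover have "H = G" if "?D r H" "?D r G" for H G
  proof -
    have pos: "std_normal_density y \<noteq> 0" for y
      using normal_density_pos[of 1 0 y] by simp
    have "poly H y = poly G y" for y
    proof -
      have "(-1) ^ r * poly H y * std_normal_density y = (-1) ^ r * poly G y * std_normal_density y"
        using that by metis
      then show ?thesis using pos[of y] by simp
    qed
    then show ?thesis by (simp add: poly_eq_poly_eq_iff[symmetric] fun_eq_iff)
  qed
  ultimately show ?thesis by blast
qed

lemmas hermite_works = theI'[OF ex1_hermite, folded hermite_def]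

(* All indices are shifted to start at 0; the cyclic convention j_(k+1) = j_1 becomes Suc t mod k. *)
definition pair_count :: "nat \<Rightarrow> (nat \<Rightarrow> nat) \<Rightarrow> (nat \<Rightarrow> nat) \<Rightarrow> nat \<Rightarrow> nat \<Rightarrow> nat" where
  "pair_count k i j r s =
     card {t. t < k \<and> (i t, j t) = (r, s)} + card {t. t < k \<and> (i t, j (Suc t mod k)) = (r, s)}"

definition U :: "nat \<Rightarrow> real mat \<Rightarrow> real" where
  "U k Y = (\<Sum>i \<in> {..<k} \<rightarrow>\<^sub>E {..<dim_row Y}. \<Sum>j \<in> {..<k} \<rightarrow>\<^sub>E {..<dim_col Y}.
     \<Prod>r<dim_row Y. \<Prod>s<dim_col Y. poly (hermite (pair_count k i j r s)) (Y $$ (r, s)))"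

definition mat_trace :: "real mat \<Rightarrow> real" where
  "mat_trace A = (\<Sum>i<dim_row A. A $$ (i, i))"

definition nondec_seqs :: "nat \<Rightarrow> nat list set" where
  "nondec_seqs l = {s. sorted s \<and> (\<forall>x\<in>set s. x > 0) \<and> sum_list s = l}"

lemma finite_nondec_seqs: "finite (nondec_seqs l)"
proof (rule finite_subset)
  have len: "length s \<le> sum_list s" if "\<forall>x\<in>set s. x > 0" for s :: "nat list"
    using that by (induction s) auto
  show "nondec_seqs l \<subseteq> {s. set s \<subseteq> {..l} \<and> length s \<le> l}"
    using len member_le_sum_list by (fastforce simp: nondec_seqs_def)
  show "finite {s. set s \<subseteq> {..l} \<and> length s \<le> l}"
    by (rule finite_lists_length_le) simp
qed

end

theory Submission
  imports Defs "HOL-Library.Multiset"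
begin

text \<open>
  The Hermite recurrence \<^term>\<open>hermite (Suc n) = [:0, 1:] * hermite n - pderiv (hermite n)\<close> says that
  the operator "multiply by \<open>y\<close>, then subtract the derivative" raises the index of a Hermite
  polynomial by one. Give every entry of the matrix such an operator
  \<open>A\<^bsub>rs\<^esub> F = Y\<^bsub>rs\<^esub> F - \<partial>F / \<partial>Y\<^bsub>rs\<^esub>\<close>. These operators commute, and applying one of
  them for each pair in a multiset to the constant 1 yields exactly the product of the Hermite
  polynomials indexed by the multiplicities. Therefore \<open>U\<^sub>k = tr ((A\<^sup>T A)\<^sup>k) 1\<close>, and it suffices to
  apply the factors \<open>A\<close> and \<open>A\<^sup>T\<close> to the identity matrix alternately and to follow the result.

  Write \<open>G = Y\<^sup>T Y\<close>. The result is always of the form "power of \<open>G\<close> plus lower order terms"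
  after an even number of steps and "\<open>Y\<close> times a power of \<open>G\<close> plus lower order terms"
  after an odd number of steps, where a lower order term is such a power multiplied by a product of
  traces of powers of \<open>G\<close>, of smaller total exponent. This class is preserved because
  multiplying by \<open>Y\<close> or \<open>Y\<^sup>T\<close> produces the expected leading term, and the three derivatives
  that occur stay inside the class and lower the degree by two compared with multiplication:

  \<^item> the gradient of \<open>tr G\<^sup>m\<close> is \<open>2 m Y G\<^bsup>m-1\<^esup>\<close> (\<open>has_partial_gram_trace\<close>);
  \<^item> the divergence \<open>\<Sum>\<^sub>l \<partial>(G\<^sup>m)\<^bsub>lj\<^esub> / \<partial>Y\<^bsub>il\<^esub>\<close> is a combination of matrices \<open>tr (G\<^sup>a) Y G\<^sup>b\<close> with
    \<open>a + b < m\<close> (\<open>gram_pow_divergence\<close>);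
  \<^item> the divergence \<open>\<Sum>\<^sub>l \<partial>(Y G\<^sup>m)\<^bsub>lj\<^esub> / \<partial>Y\<^bsub>li\<^esub>\<close> is a combination of matrices \<open>tr (G\<^sup>a) G\<^sup>b\<close> with
    \<open>a + b \<le> m\<close>, where \<open>p\<close> also occurs as a coefficient (\<open>obs_gram_pow_divergence\<close>).

  Induction on the number of steps (\<open>even_walks_expansion\<close>) shows that \<open>U\<^sub>k\<close> is the trace of
  \<open>G\<^sup>k\<close> plus the trace of a combination of total exponent below \<open>k\<close>. Collecting the latter by the
  sorted list of its exponents (\<open>trace_combination\<close>) gives the coefficients, which never
  involve the entries of \<open>Y\<close>.
\<close>

text \<open>
  A matrix is represented by its entry function, so that perturbing one entry is a function update.
\<close>

type_synonym entries = "nat \<times> nat \<Rightarrow> real"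

section \<open>Hermite polynomials\<close>

lemma hermite_0: "hermite 0 = 1"
proof -
  have "poly (hermite 0) y = poly 1 y" for y
  proof -
    have "std_normal_density y = poly (hermite 0) y * std_normal_density y"
      using hermite_works[of 0] by simp
    then show ?thesis
      using normal_density_pos[of 1 0 y] by simp
  qed
  then show ?thesis
    by (simp add: poly_eq_poly_eq_iff[symmetric] fun_eq_iff)
qed

lemma hermite_Suc: "hermite (Suc n) = [:0, 1:] * hermite n - pderiv (hermite n)"
proof -
  have "poly (hermite (Suc n)) y = poly ([:0, 1:] * hermite n - pderiv (hermite n)) y" for y
  proof -
    have eq: "(deriv ^^ n) std_normal_density
        = (\<lambda>y. (-1) ^ n * poly (hermite n) y * std_normal_density y)"
      using hermite_works[of n] by auto
    have "(-1) ^ Suc n * poly (hermite (Suc n)) y * std_normal_density y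
        = (deriv ^^ Suc n) std_normal_density y"
      using hermite_works[of "Suc n"] by simp
    also have "\<dots> = (-1) ^ n * poly (pderiv (hermite n) - [:0, 1:] * hermite n) y
        * std_normal_density y"
      using DERIV_imp_deriv[OF deriv_std_normal_density_poly[of "(-1) ^ n" "hermite n" y]]
      by (simp add: eq)
    also have "\<dots> = (-1) ^ Suc n * poly ([:0, 1:] * hermite n - pderiv (hermite n)) y
        * std_normal_density y"
      by (simp add: algebra_simps)
    finally show ?thesis
      using normal_density_pos[of 1 0 y] by simp
  qed
  then show ?thesis
    by (simp add: poly_eq_poly_eq_iff[symmetric] fun_eq_iff)
qed

section \<open>Partial derivatives\<close>

text \<open>
  A relation between functions, rather than a derivative operator, so that differentiability is
  carried along with the value and the sum and product rules need no side conditions.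
\<close>

definition has_partial :: "nat \<times> nat \<Rightarrow> (entries \<Rightarrow> real) \<Rightarrow> (entries \<Rightarrow> real) \<Rightarrow> bool" where
  "has_partial rs F F' \<longleftrightarrow>
     (\<forall>Y. ((\<lambda>x. F (Y(rs := Y rs + x))) has_real_derivative F' Y) (at 0))"

lemma has_partial_unique: "has_partial rs F F1 \<Longrightarrow> has_partial rs F F2 \<Longrightarrow> F1 = F2"
  unfolding has_partial_def by (blast intro: DERIV_unique)

lemma has_partial_const: "has_partial rs (\<lambda>Y. c) (\<lambda>Y. 0)"
  by (simp add: has_partial_def)

lemma has_partial_entry: "has_partial rs (\<lambda>Y. Y e) (\<lambda>Y. if e = rs then 1 else 0)"
  by (auto simp: has_partial_def intro!: derivative_eq_intros)

lemma has_partial_add: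
  "has_partial rs F F' \<Longrightarrow> has_partial rs H H' \<Longrightarrow>
   has_partial rs (\<lambda>Y. F Y + H Y) (\<lambda>Y. F' Y + H' Y)"
  by (auto simp: has_partial_def intro!: DERIV_add)

lemma has_partial_mult:
  assumes "has_partial rs F F'" "has_partial rs H H'"
  shows "has_partial rs (\<lambda>Y. F Y * H Y) (\<lambda>Y. F' Y * H Y + F Y * H' Y)"
  unfolding has_partial_def
proof
  fix Y
  show "((\<lambda>x. F (Y(rs := Y rs + x)) * H (Y(rs := Y rs + x)))
      has_real_derivative F' Y * H Y + F Y * H' Y) (at 0)"
    using DERIV_mult[OF assms[unfolded has_partial_def, rule_format, of Y]]
    by (simp add: mult.commute)
qed

lemma has_partial_sum:
  "(\<And>x. x \<in> A \<Longrightarrow> has_partial rs (F x) (F' x)) \<Longrightarrow>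
   has_partial rs (\<lambda>Y. \<Sum>x\<in>A. F x Y) (\<lambda>Y. \<Sum>x\<in>A. F' x Y)"
  by (auto simp: has_partial_def intro!: DERIV_sum)

section \<open>Traces of powers of the Gram matrix\<close>

context
  fixes p q :: nat
begin

definition gram :: "entries \<Rightarrow> nat \<Rightarrow> nat \<Rightarrow> real" where
  "gram Y b c = (\<Sum>a<p. Y (a, b) * Y (a, c))"

fun gram_pow :: "nat \<Rightarrow> entries \<Rightarrow> nat \<Rightarrow> nat \<Rightarrow> real" where
  "gram_pow 0 Y i j = (if i = j then 1 else 0)"
| "gram_pow (Suc m) Y i j = (\<Sum>b<q. gram_pow m Y i b * gram Y b j)"

text \<open>The entries of \<open>Y (Y\<^sup>T Y)\<^sup>m\<close>.\<close>

definition obs_gram_pow :: "nat \<Rightarrow> entries \<Rightarrow> nat \<Rightarrow> nat \<Rightarrow> real" where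
  "obs_gram_pow m Y i j = (\<Sum>b<q. Y (i, b) * gram_pow m Y b j)"

definition gram_trace :: "nat \<Rightarrow> entries \<Rightarrow> real" where
  "gram_trace m Y = (\<Sum>a<q. gram_pow m Y a a)"

definition trace_monomial :: "nat list \<Rightarrow> entries \<Rightarrow> real" where
  "trace_monomial s Y = (\<Prod>m\<leftarrow>s. gram_trace m Y)"

declare gram_pow.simps(2) [simp del]

lemma gram_commute: "gram Y b c = gram Y c b"
  by (simp add: gram_def mult.commute)

lemma sum_mult_assoc:
  fixes f :: "nat \<Rightarrow> real"
  shows "(\<Sum>b\<in>B. (\<Sum>a\<in>A. f a * g a b) * h b) = (\<Sum>a\<in>A. f a * (\<Sum>b\<in>B. g a b * h b))"
  by (simp add: sum_distrib_left sum_distrib_right mult.assoc) (rule sum.swap)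

lemma sum_kronecker:
  fixes f :: "nat \<Rightarrow> real"
  shows "i < n \<Longrightarrow> (\<Sum>a<n. f a * (if a = i then 1 else 0)) = f i"
    and "i < n \<Longrightarrow> (\<Sum>a<n. f a * (if i = a then 1 else 0)) = f i"
    and "i < n \<Longrightarrow> (\<Sum>a<n. (if a = i then 1 else 0) * f a) = f i"
    and "i < n \<Longrightarrow> (\<Sum>a<n. (if i = a then 1 else 0) * f a) = f i"
  by (simp_all add: if_distrib if_distribR cong: if_cong)

lemma gram_pow_add:
  "j < q \<Longrightarrow> (\<Sum>b<q. gram_pow m Y i b * gram_pow n Y b j) = gram_pow (m + n) Y i j"
proof (induction n arbitrary: j)
  case 0
  then show ?case by (simp add: sum_kronecker)
next
  case (Suc n)
  have "(\<Sum>b<q. gram_pow m Y i b * gram_pow (Suc n) Y b j)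
      = (\<Sum>c<q. (\<Sum>b<q. gram_pow m Y i b * gram_pow n Y b c) * gram Y c j)"
    by (simp add: sum_mult_assoc gram_pow.simps)
  also have "\<dots> = (\<Sum>c<q. gram_pow (m + n) Y i c * gram Y c j)"
    using Suc.IH by simp
  finally show ?case by (simp add: gram_pow.simps)
qed

lemma gram_pow_1: "i < q \<Longrightarrow> gram_pow (Suc 0) Y i j = gram Y i j"
  by (simp add: gram_pow.simps sum_kronecker)

lemma gram_pow_commute: "i < q \<Longrightarrow> j < q \<Longrightarrow> gram_pow m Y i j = gram_pow m Y j i"
proof (induction m arbitrary: i j)
  case 0
  then show ?case by simp
next
  case (Suc m)
  have "gram_pow (Suc m) Y i j = (\<Sum>b<q. gram_pow (Suc 0) Y j b * gram_pow m Y b i)"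
    using Suc by (auto intro!: sum.cong simp: gram_pow_1 gram_commute mult.commute gram_pow.simps(2)[of m])
  also have "\<dots> = gram_pow (Suc m) Y j i"
    using Suc.prems gram_pow_add[of i "Suc 0" Y j m] by simp
  finally show ?case .
qed

lemma obs_gram_pow_0: "j < q \<Longrightarrow> obs_gram_pow 0 Y i j = Y (i, j)"
  by (simp add: obs_gram_pow_def sum_kronecker)

lemma obs_gram_pow_mult:
  "j < q \<Longrightarrow> (\<Sum>b<q. obs_gram_pow m Y i b * gram_pow n Y b j) = obs_gram_pow (m + n) Y i j"
  by (simp add: obs_gram_pow_def sum_mult_assoc gram_pow_add)

text \<open>
  \<open>(Y G\<^sup>m)\<^sup>T (Y G\<^sup>n) = G\<^bsup>m+n+1\<^esup>\<close>, because the powers of \<open>G\<close> are symmetric.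
\<close>

lemma obs_gram_pow_inner:
  assumes "i < q" "j < q"
  shows "(\<Sum>l<p. obs_gram_pow m Y l i * obs_gram_pow n Y l j) = gram_pow (Suc (m + n)) Y i j"
proof -
  have "(\<Sum>l<p. obs_gram_pow m Y l i * obs_gram_pow n Y l j)
      = (\<Sum>l<p. (\<Sum>b<q. gram_pow m Y i b * Y (l, b)) * (\<Sum>c<q. Y (l, c) * gram_pow n Y c j))"
    using assms(1) by (auto intro!: sum.cong simp: obs_gram_pow_def mult.commute gram_pow_commute)
  also have "\<dots> = (\<Sum>b<q. gram_pow m Y i b * (\<Sum>l<p. Y (l, b) * (\<Sum>c<q. Y (l, c) * gram_pow n Y c j)))"
    by (rule sum_mult_assoc)
  also have "\<dots> = (\<Sum>b<q. gram_pow m Y i b * (\<Sum>c<q. gram Y b c * gram_pow n Y c j))"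
    unfolding gram_def by (subst sum_mult_assoc) simp
  also have "\<dots> = (\<Sum>c<q. gram_pow (Suc m) Y i c * gram_pow n Y c j)"
    by (simp add: sum_mult_assoc gram_pow.simps)
  finally show ?thesis
    using assms(2) by (simp add: gram_pow_add)
qed

lemma obs_mult_obs_gram_pow:
  assumes "i < q" "j < q"
  shows "(\<Sum>l<p. Y (l, i) * obs_gram_pow m Y l j) = gram_pow (Suc m) Y i j"
  using obs_gram_pow_inner[OF assms, of 0 Y m] assms(1)
  by (simp add: obs_gram_pow_0)

section \<open>Derivatives of the powers and of their traces\<close>

text \<open>
  The two summands come from the two occurrences of \<open>Y\<close> in \<open>Y\<^sup>T Y\<close>.
\<close>

definition d_gram :: "nat \<times> nat \<Rightarrow> entries \<Rightarrow> nat \<Rightarrow> nat \<Rightarrow> real" where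
  "d_gram rs Y b c =
     (if b = snd rs then Y (fst rs, c) else 0) + (if c = snd rs then Y (fst rs, b) else 0)"

fun d_gram_pow :: "nat \<Rightarrow> nat \<times> nat \<Rightarrow> entries \<Rightarrow> nat \<Rightarrow> nat \<Rightarrow> real" where
  "d_gram_pow 0 rs Y i j = 0"
| "d_gram_pow (Suc m) rs Y i j =
     (\<Sum>b<q. d_gram_pow m rs Y i b * gram Y b j + gram_pow m Y i b * d_gram rs Y b j)"

declare d_gram_pow.simps(2) [simp del]

lemma has_partial_gram:
  assumes "fst rs < p"
  shows "has_partial rs (\<lambda>Y. gram Y b c) (\<lambda>Y. d_gram rs Y b c)"
proof -
  have "has_partial rs (\<lambda>Y. gram Y b c)
    (\<lambda>Y. \<Sum>a<p. (if (a, b) = rs then 1 else 0) * Y (a, c) + Y (a, b) * (if (a, c) = rs then 1 else 0))"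
    unfolding gram_def by (intro has_partial_sum has_partial_mult has_partial_entry)
  also have "(\<lambda>Y. \<Sum>a<p. (if (a, b) = rs then 1 else 0) * Y (a, c)
      + Y (a, b) * (if (a, c) = rs then 1 else 0)) = (\<lambda>Y. d_gram rs Y b c)"
    using assms
    by (cases rs) (auto simp: fun_eq_iff d_gram_def sum.distrib sum_kronecker)
  finally show ?thesis .
qed

lemma has_partial_gram_pow:
  "fst rs < p \<Longrightarrow> has_partial rs (\<lambda>Y. gram_pow m Y i j) (\<lambda>Y. d_gram_pow m rs Y i j)"
  by (induction m arbitrary: j)
     (auto simp: d_gram_pow.simps(2) gram_pow.simps(2) simp del: if_split
       intro!: has_partial_const has_partial_sum has_partial_mult has_partial_gram)

lemma sum_gram_pow_d_gram:
  assumes "s < q"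
  shows "(\<Sum>i<q. \<Sum>j<q. gram_pow n Y j i * d_gram (r, s) Y i j) = 2 * obs_gram_pow n Y r s"
proof -
  have "(\<Sum>i<q. \<Sum>j<q. gram_pow n Y j i * d_gram (r, s) Y i j)
    = (\<Sum>i<q. \<Sum>j<q. gram_pow n Y j i * (if i = s then Y (r, j) else 0))
      + (\<Sum>i<q. \<Sum>j<q. gram_pow n Y j i * (if j = s then Y (r, i) else 0))"
    by (simp only: d_gram_def sum.distrib distrib_left fst_conv snd_conv)
  also have "(\<Sum>i<q. \<Sum>j<q. gram_pow n Y j i * (if i = s then Y (r, j) else 0)) = obs_gram_pow n Y r s"
    by (subst sum.swap)
       (use assms in \<open>simp add: obs_gram_pow_def if_distrib mult.commute cong: if_cong\<close>)
  also have "(\<Sum>i<q. \<Sum>j<q. gram_pow n Y j i * (if j = s then Y (r, i) else 0)) = obs_gram_pow n Y r s"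
    using assms by (auto intro!: sum.cong simp: obs_gram_pow_def if_distrib mult.commute
       gram_pow_commute[of s] cong: if_cong)
  finally show ?thesis by simp
qed

text \<open>
  Since the trace is cyclic, each of the \<open>m + 1\<close> factors of \<open>G\<^bsup>m+1\<^esup>\<close> contributes the same amount to
  \<open>tr (G\<^sup>n dG\<^bsup>m+1\<^esup>)\<close>. The extra factor \<open>G\<^sup>n\<close> makes induction possible: splitting off one
  factor of \<open>G\<^bsup>m+1\<^esup>\<close> and moving it around the trace increases \<open>n\<close>.
\<close>

lemma sum_gram_pow_d_gram_pow:
  assumes "s < q"
  shows "(\<Sum>i<q. \<Sum>j<q. gram_pow n Y j i * d_gram_pow (Suc m) (r, s) Y i j)
      = 2 * real (Suc m) * obs_gram_pow (n + m) Y r s"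
proof (induction m arbitrary: n)
  case 0
  have "(\<Sum>i<q. \<Sum>j<q. gram_pow n Y j i * d_gram_pow (Suc 0) (r, s) Y i j)
     = (\<Sum>i<q. \<Sum>j<q. gram_pow n Y j i * d_gram (r, s) Y i j)"
    by (auto intro!: sum.cong simp: d_gram_pow.simps sum_kronecker)
  then show ?case using sum_gram_pow_d_gram[OF assms] by simp
next
  case (Suc m)
  let ?D = "d_gram_pow (Suc m) (r, s) Y" and ?G = "\<lambda>n. gram_pow n Y" and ?d = "d_gram (r, s) Y"
  have "(\<Sum>i<q. \<Sum>j<q. ?G n j i * d_gram_pow (Suc (Suc m)) (r, s) Y i j)
     = (\<Sum>i<q. \<Sum>j<q. \<Sum>b<q. ?G n j i * ?D i b * gram Y b j)
       + (\<Sum>i<q. \<Sum>j<q. \<Sum>b<q. ?G n j i * ?G (Suc m) i b * ?d b j)"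
    by (subst d_gram_pow.simps)
       (simp add: sum.distrib sum_distrib_left distrib_left mult.assoc)
  \<comment> \<open>move the last factor to the front of the trace\<close>
  also have "(\<Sum>i<q. \<Sum>j<q. \<Sum>b<q. ?G n j i * ?D i b * gram Y b j)
     = (\<Sum>i<q. \<Sum>b<q. (\<Sum>j<q. gram_pow (Suc 0) Y b j * ?G n j i) * ?D i b)"
  proof (rule sum.cong[OF refl])
    fix i
    show "(\<Sum>j<q. \<Sum>b<q. ?G n j i * ?D i b * gram Y b j)
     = (\<Sum>b<q. (\<Sum>j<q. gram_pow (Suc 0) Y b j * ?G n j i) * ?D i b)"
      by (subst sum.swap)
         (auto intro!: sum.cong simp: gram_pow_1 gram_commute sum_distrib_left sum_distrib_right mult_ac
          )
  qed
  also have "\<dots> = (\<Sum>i<q. \<Sum>b<q. ?G (Suc n) b i * ?D i b)"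
    using gram_pow_add[of _ "Suc 0" Y _ n]
    by (auto intro!: sum.cong)
  also have "\<dots> = 2 * real (Suc m) * obs_gram_pow (n + Suc m) Y r s"
    using Suc.IH[of "Suc n"] by simp
  also have "(\<Sum>i<q. \<Sum>j<q. \<Sum>b<q. ?G n j i * ?G (Suc m) i b * ?d b j)
     = (\<Sum>j<q. \<Sum>b<q. \<Sum>i<q. ?G n j i * ?G (Suc m) i b * ?d b j)"
    by (subst sum.swap) (rule sum.cong[OF refl], rule sum.swap)
  also have "\<dots> = (\<Sum>j<q. \<Sum>b<q. ?G (n + Suc m) j b * ?d b j)"
    by (auto intro!: sum.cong simp: gram_pow_add sum_distrib_right[symmetric])
  also have "\<dots> = 2 * obs_gram_pow (n + Suc m) Y r s"
    by (subst sum.swap) (rule sum_gram_pow_d_gram[OF assms])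
  finally show ?case
    by (simp add: algebra_simps)
qed

lemma has_partial_gram_trace:
  assumes "r < p" "s < q"
  shows "has_partial (r, s) (gram_trace m) (\<lambda>Y. 2 * real m * obs_gram_pow (m - 1) Y r s)"
proof -
  have "has_partial (r, s) (\<lambda>Y. \<Sum>a<q. gram_pow m Y a a) (\<lambda>Y. \<Sum>a<q. d_gram_pow m (r, s) Y a a)"
    using assms by (intro has_partial_sum has_partial_gram_pow) auto
  moreover have "(\<Sum>a<q. d_gram_pow m (r, s) Y a a) = 2 * real m * obs_gram_pow (m - 1) Y r s" for Y
  proof (cases m)
    case (Suc n)
    have "(\<Sum>a<q. d_gram_pow m (r, s) Y a a)
      = (\<Sum>i<q. \<Sum>j<q. gram_pow 0 Y j i * d_gram_pow (Suc n) (r, s) Y i j)"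
      by (auto intro!: sum.cong simp: Suc sum_kronecker)
    then show ?thesis using sum_gram_pow_d_gram_pow[OF assms(2), of 0 Y n r] Suc by simp
  qed simp
  ultimately show ?thesis
    by (simp add: gram_trace_def[abs_def])
qed

section \<open>Combinations of matrix powers with trace coefficients\<close>

type_synonym matrix_fun = "entries \<Rightarrow> nat \<Rightarrow> nat \<Rightarrow> real"

text \<open>
  \<^term>\<open>combination N W d\<close> is the linear span of the matrix functions \<open>tr G\<^bsup>s1\<^esup> \<cdots> tr G\<^bsup>sr\<^esup> W\<^sub>m\<close>
  with \<open>s1 + \<cdots> + sr + m < d\<close>, where \<open>W\<close> is the family of powers \<open>G\<^sup>m\<close> (with \<open>N = q\<close>
  rows) or of matrices \<open>Y G\<^sup>m\<close> (with \<open>N = p\<close> rows). Membership depends only on the values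
  in the index range, because the identities between matrix products fail outside it. The bound is strict
  so that weight \<open>d\<close> describes the terms strictly below a leading term with exponent \<open>d\<close>. Zero
  exponents are allowed in \<open>s\<close>: they stand for the constant factor \<open>tr G\<^sup>0 = q\<close>.
\<close>

inductive combination :: "nat \<Rightarrow> (nat \<Rightarrow> matrix_fun) \<Rightarrow> nat \<Rightarrow> matrix_fun \<Rightarrow> bool"
  for N W d where
  zero: "(\<And>Y i j. i < N \<Longrightarrow> j < q \<Longrightarrow> X Y i j = 0) \<Longrightarrow> combination N W d X"
| step: "combination N W d X \<Longrightarrow> sum_list s + m < d \<Longrightarrow>
    (\<And>Y i j. i < N \<Longrightarrow> j < q \<Longrightarrow> X' Y i j = c * trace_monomial s Y * W m Y i j + X Y i j) \<Longrightarrow>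
    combination N W d X'"

lemma combination_term:
  "sum_list s + m < d \<Longrightarrow> combination N W d (\<lambda>Y i j. c * trace_monomial s Y * W m Y i j)"
  by (rule combination.step[OF combination.zero[of N "\<lambda>_ _ _. 0"]]) auto

lemma combination_mono: "combination N W d X \<Longrightarrow> d \<le> d' \<Longrightarrow> combination N W d' X"
proof (induction rule: combination.induct)
  case (zero X)
  then show ?case by (intro combination.zero) auto
next
  case (step X s m X' c)
  show ?case
    by (rule combination.step[OF step.IH[OF step.prems], of s m _ c])
       (use step.hyps step.prems in auto)
qed

lemma combination_cong:
  assumes "combination N W d X" "\<And>Y i j. i < N \<Longrightarrow> j < q \<Longrightarrow> X' Y i j = X Y i j"
  shows "combination N W d X'"
  using assms by (cases rule: combination.cases) (auto intro: combination.intros)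

lemma combination_add:
  assumes "combination N W d X" "combination N W d X'"
  shows "combination N W d (\<lambda>Y i j. X Y i j + X' Y i j)"
  using assms(1)
proof (induction rule: combination.induct)
  case (zero X)
  then show ?case by (intro combination_cong[OF assms(2)]) auto
next
  case (step X s m X'' c)
  show ?case by (rule combination.step[OF step.IH step.hyps(2), of _ c]) (use step.hyps in auto)
qed

lemma trace_monomial_simps:
  "trace_monomial [] Y = 1"
  "trace_monomial (m # s) Y = gram_trace m Y * trace_monomial s Y"
  "trace_monomial (s @ s') Y = trace_monomial s Y * trace_monomial s' Y"
  by (simp_all add: trace_monomial_def)

lemma combination_scale:
  assumes "combination N W d X"
  shows "combination N W (sum_list s + d) (\<lambda>Y i j. c * trace_monomial s Y * X Y i j)"
  using assms
proof (induction rule: combination.induct)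
  case (zero X)
  then show ?case by (intro combination.zero) auto
next
  case (step X s' m X' c')
  show ?case
    by (rule combination.step[OF step.IH, of "s @ s'" m _ "c * c'"])
       (use step.hyps in \<open>auto simp: trace_monomial_simps algebra_simps\<close>)
qed

lemma combination_mult_gram_pow:
  assumes "combination N W d X"
    and W: "\<And>m Y i j. i < N \<Longrightarrow> j < q \<Longrightarrow> (\<Sum>b<q. W m Y i b * gram_pow n Y b j) = W (m + n) Y i j"
  shows "combination N W (d + n) (\<lambda>Y i j. \<Sum>b<q. X Y i b * gram_pow n Y b j)"
  using assms(1)
proof (induction rule: combination.induct)
  case (zero X)
  then show ?case by (intro combination.zero) auto
next
  case (step X s m X' c)
  show ?case
    by (rule combination.step[OF step.IH, of s "m + n" _ c])
       (use step.hyps in \<open>auto simp: W[symmetric] sum_distrib_left sum.distrib algebra_simps\<close>)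
qed

lemma combination_inner_obs_gram_pow:
  assumes "combination p obs_gram_pow d X"
  shows "combination q gram_pow (Suc (d + n)) (\<lambda>Y i j. \<Sum>l<p. X Y l i * obs_gram_pow n Y l j)"
  using assms
proof (induction rule: combination.induct)
  case (zero X)
  then show ?case by (intro combination.zero) auto
next
  case (step X s m X' c)
  show ?case
    by (rule combination.step[OF step.IH, of s "Suc (m + n)" _ c])
       (use step.hyps in \<open>auto simp: obs_gram_pow_inner[symmetric] sum_distrib_left sum.distrib algebra_simps
        \<close>)
qed

section \<open>Gradients and divergences\<close>

text \<open>
  By the product rule, differentiating the factor \<open>tr G\<^sup>m\<close> replaces it by a multiple of
  \<open>Y G\<^bsup>m-1\<^esup>\<close>. One unit of exponent is lost, which is why the strict bound is the sum of \<open>s\<close>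
  itself.
\<close>

lemma trace_monomial_gradient:
  "\<exists>D. combination p obs_gram_pow (sum_list s) D \<and>
     (\<forall>r<p. \<forall>t<q. has_partial (r, t) (trace_monomial s) (\<lambda>Y. D Y r t))"
proof (induction s)
  case Nil
  show ?case
    by (rule exI[of _ "\<lambda>_ _ _. 0"])
       (auto intro!: combination.zero has_partial_const simp: trace_monomial_simps[abs_def])
next
  case (Cons m s)
  then obtain D where D: "combination p obs_gram_pow (sum_list s) D"
    "\<And>r t. r < p \<Longrightarrow> t < q \<Longrightarrow> has_partial (r, t) (trace_monomial s) (\<lambda>Y. D Y r t)"
    by blast
  define T where "T = (\<lambda>Y r t. 2 * real m * trace_monomial s Y * obs_gram_pow (m - 1) Y r t)"
  define D' where "D' = (\<lambda>Y r t. T Y r t + 1 * trace_monomial [m] Y * D Y r t)"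
  have "combination p obs_gram_pow (sum_list (m # s)) T"
  proof (cases "m = 0")
    case True
    then show ?thesis by (auto simp: T_def intro: combination.zero)
  next
    case False
    then show ?thesis unfolding T_def by (intro combination_term) auto
  qed
  moreover have "combination p obs_gram_pow (sum_list (m # s))
      (\<lambda>Y r t. 1 * trace_monomial [m] Y * D Y r t)"
    using combination_scale[OF D(1), of "[m]" 1] by simp
  ultimately have "combination p obs_gram_pow (sum_list (m # s)) D'"
    unfolding D'_def by (rule combination_add)
  moreover have "has_partial (r, t) (trace_monomial (m # s)) (\<lambda>Y. D' Y r t)" if "r < p" "t < q" for r t
    using has_partial_mult[OF has_partial_gram_trace[OF that, of m] D(2)[OF that]]
    by (simp add: D'_def T_def trace_monomial_simps[abs_def] mult_ac)
  ultimately show ?case by blast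
qed

text \<open>
  With \<open>L\<^sub>m\<close> for the divergence, splitting off the last factor of \<open>G\<^bsup>m+1\<^esup>\<close> gives
  \<open>L\<^bsub>m+1\<^esub> = L\<^sub>m G + tr (G\<^sup>m) Y + Y G\<^sup>m\<close>: the derivative of that factor hits either its \<open>Y\<close>, which
  closes a cycle and produces a trace, or its \<open>Y\<^sup>T\<close>, which extends the product.
\<close>

lemma gram_pow_divergence:
  "combination p obs_gram_pow m (\<lambda>Y i j. \<Sum>l<q. d_gram_pow m (i, l) Y l j)"
proof (induction m)
  case 0
  show ?case by (rule combination.zero) simp
next
  case (Suc m)
  let ?L = "\<lambda>Y i j. \<Sum>l<q. d_gram_pow m (i, l) Y l j"
  have 1: "combination p obs_gram_pow (Suc m) (\<lambda>Y i j. \<Sum>b<q. ?L Y i b * gram_pow 1 Y b j)"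
    using combination_mult_gram_pow[OF Suc obs_gram_pow_mult, of 1] by simp
  have 2: "combination p obs_gram_pow (Suc m) (\<lambda>Y i j. 1 * trace_monomial [m] Y * obs_gram_pow 0 Y i j)"
    by (rule combination_term) simp
  have 3: "combination p obs_gram_pow (Suc m) (\<lambda>Y i j. 1 * trace_monomial [] Y * obs_gram_pow m Y i j)"
    by (rule combination_term) simp
  show ?case
  proof (rule combination_cong[OF combination_add[OF 1 combination_add[OF 2 3]]])
    fix Y i j
    assume ij: "i < p" "j < q"
    have "(\<Sum>l<q. d_gram_pow (Suc m) (i, l) Y l j)
        = (\<Sum>l<q. \<Sum>b<q. d_gram_pow m (i, l) Y l b * gram Y b j)
          + (\<Sum>l<q. \<Sum>b<q. gram_pow m Y l b * (if b = l then Y (i, j) else 0))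
          + (\<Sum>l<q. \<Sum>b<q. gram_pow m Y l b * (if j = l then Y (i, b) else 0))"
      by (simp only: d_gram_pow.simps d_gram_def sum.distrib distrib_left fst_conv snd_conv add.assoc)
    also have "(\<Sum>l<q. \<Sum>b<q. d_gram_pow m (i, l) Y l b * gram Y b j)
        = (\<Sum>b<q. ?L Y i b * gram_pow 1 Y b j)"
      by (subst sum.swap) (simp add: gram_pow_1 sum_distrib_right)
    also have "(\<Sum>l<q. \<Sum>b<q. gram_pow m Y l b * (if b = l then Y (i, j) else 0))
        = gram_trace m Y * Y (i, j)"
      by (simp add: gram_trace_def sum_distrib_right if_distrib cong: if_cong)
    also have "(\<Sum>l<q. \<Sum>b<q. gram_pow m Y l b * (if j = l then Y (i, b) else 0))
        = obs_gram_pow m Y i j"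
      by (subst sum.swap)
         (use ij in \<open>auto intro!: sum.cong simp: obs_gram_pow_def if_distrib mult.commute
           gram_pow_commute[of j] cong: if_cong\<close>)
    finally show "(\<Sum>l<q. d_gram_pow (Suc m) (i, l) Y l j)
      = (\<Sum>b<q. ?L Y i b * gram_pow 1 Y b j)
        + (1 * trace_monomial [m] Y * obs_gram_pow 0 Y i j + 1 * trace_monomial [] Y * obs_gram_pow m Y i j)"
      using ij by (simp add: trace_monomial_simps obs_gram_pow_0)
  qed
qed

definition d_obs_gram_pow :: "nat \<Rightarrow> nat \<times> nat \<Rightarrow> matrix_fun" where
  "d_obs_gram_pow m rs Y i j =
     (\<Sum>b<q. (if (i, b) = rs then 1 else 0) * gram_pow m Y b j + Y (i, b) * d_gram_pow m rs Y b j)"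

lemma has_partial_obs_gram_pow:
  "fst rs < p \<Longrightarrow> has_partial rs (\<lambda>Y. obs_gram_pow m Y i j) (\<lambda>Y. d_obs_gram_pow m rs Y i j)"
  unfolding obs_gram_pow_def d_obs_gram_pow_def
  by (intro has_partial_sum has_partial_mult has_partial_entry has_partial_gram_pow)

text \<open>
  This is the part of the divergence of \<open>Y G\<^sup>m\<close> in which the leading \<open>Y\<close> is not
  differentiated. Calling it \<open>M\<^sub>m\<close>, the last factor of \<open>G\<^bsup>m+1\<^esup>\<close> now gives
  \<open>M\<^bsub>m+1\<^esub> = M\<^sub>m G + G\<^bsup>m+1\<^esup> + tr (G\<^bsup>m+1\<^esup>) I\<close>.
\<close>

lemma gram_pow_weighted_divergence:
  "combination q gram_pow (Suc m) (\<lambda>Y i j. \<Sum>l<p. \<Sum>b<q. Y (l, b) * d_gram_pow m (l, i) Y b j)"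
proof (induction m)
  case 0
  show ?case by (rule combination.zero) simp
next
  case (Suc m)
  let ?M = "\<lambda>Y i j. \<Sum>l<p. \<Sum>b<q. Y (l, b) * d_gram_pow m (l, i) Y b j"
  have 1: "combination q gram_pow (Suc (Suc m)) (\<lambda>Y i j. \<Sum>b<q. ?M Y i b * gram_pow 1 Y b j)"
    using combination_mult_gram_pow[OF Suc gram_pow_add, of 1] by simp
  have 2: "combination q gram_pow (Suc (Suc m))
      (\<lambda>Y i j. 1 * trace_monomial [] Y * gram_pow (Suc m) Y i j)"
    by (rule combination_term) simp
  have 3: "combination q gram_pow (Suc (Suc m))
      (\<lambda>Y i j. 1 * trace_monomial [Suc m] Y * gram_pow 0 Y i j)"
    by (rule combination_term) simp
  show ?case
  proof (rule combination_cong[OF combination_add[OF 1 combination_add[OF 2 3]]])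
    fix Y i j
    assume ij: "i < q" "j < q"
    have "(\<Sum>l<p. \<Sum>b<q. Y (l, b) * d_gram_pow (Suc m) (l, i) Y b j)
      = (\<Sum>l<p. \<Sum>b<q. Y (l, b) * (\<Sum>c<q. d_gram_pow m (l, i) Y b c * gram Y c j))
        + (\<Sum>l<p. \<Sum>b<q. Y (l, b) * (\<Sum>c<q. gram_pow m Y b c * d_gram (l, i) Y c j))"
      by (simp only: d_gram_pow.simps sum.distrib distrib_left)
    also have "(\<Sum>l<p. \<Sum>b<q. Y (l, b) * (\<Sum>c<q. d_gram_pow m (l, i) Y b c * gram Y c j))
      = (\<Sum>l<p. \<Sum>c<q. (\<Sum>b<q. Y (l, b) * d_gram_pow m (l, i) Y b c) * gram Y c j)"
      by (simp only: sum_mult_assoc)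
    also have "\<dots> = (\<Sum>c<q. ?M Y i c * gram_pow 1 Y c j)"
      by (subst sum.swap) (simp add: gram_pow_1 sum_distrib_right)
    also have "(\<Sum>l<p. \<Sum>b<q. Y (l, b) * (\<Sum>c<q. gram_pow m Y b c * d_gram (l, i) Y c j))
      = (\<Sum>l<p. \<Sum>c<q. obs_gram_pow m Y l c * d_gram (l, i) Y c j)"
      by (simp only: sum_mult_assoc[symmetric] obs_gram_pow_def)
    also have "\<dots> = (\<Sum>l<p. \<Sum>c<q. obs_gram_pow m Y l c * (if c = i then Y (l, j) else 0))
        + (\<Sum>l<p. \<Sum>c<q. obs_gram_pow m Y l c * (if j = i then Y (l, c) else 0))"
      by (simp only: d_gram_def sum.distrib distrib_left fst_conv snd_conv)
    also have "(\<Sum>l<p. \<Sum>c<q. obs_gram_pow m Y l c * (if c = i then Y (l, j) else 0))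
        = (\<Sum>l<p. Y (l, j) * obs_gram_pow m Y l i)"
      using ij by (simp add: if_distrib mult.commute cong: if_cong)
    also have "\<dots> = gram_pow (Suc m) Y i j"
      using ij by (simp add: obs_mult_obs_gram_pow gram_pow_commute[of j])
    also have "(\<Sum>l<p. \<Sum>c<q. obs_gram_pow m Y l c * (if j = i then Y (l, c) else 0))
        = (if j = i then \<Sum>c<q. \<Sum>l<p. Y (l, c) * obs_gram_pow m Y l c else 0)"
      by (subst sum.swap) (simp add: mult.commute)
    also have "\<dots> = gram_trace (Suc m) Y * gram_pow 0 Y i j"
      by (simp add: gram_trace_def obs_mult_obs_gram_pow)
    finally show "(\<Sum>l<p. \<Sum>b<q. Y (l, b) * d_gram_pow (Suc m) (l, i) Y b j)
      = (\<Sum>b<q. ?M Y i b * gram_pow 1 Y b j)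
        + (1 * trace_monomial [] Y * gram_pow (Suc m) Y i j
          + 1 * trace_monomial [Suc m] Y * gram_pow 0 Y i j)"
      by (simp only: trace_monomial_simps mult_1_left mult_1_right)
  qed
qed

text \<open>
  Differentiating the leading \<open>Y\<close> in \<open>Y G\<^sup>m\<close> leaves \<open>G\<^sup>m\<close> once for each of the \<open>p\<close> rows.
\<close>

lemma obs_gram_pow_divergence:
  "combination q gram_pow (Suc m) (\<lambda>Y i j. \<Sum>l<p. d_obs_gram_pow m (l, i) Y l j)"
proof (rule combination_cong[OF combination_add[OF _ gram_pow_weighted_divergence]])
  show "combination q gram_pow (Suc m) (\<lambda>Y i j. real p * trace_monomial [] Y * gram_pow m Y i j)"
    by (rule combination_term) simp
  fix Y i j
  assume "i < q" "j < q"
  then show "(\<Sum>l<p. d_obs_gram_pow m (l, i) Y l j)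
    = real p * trace_monomial [] Y * gram_pow m Y i j
      + (\<Sum>l<p. \<Sum>b<q. Y (l, b) * d_gram_pow m (l, i) Y b j)"
    by (simp add: d_obs_gram_pow_def sum.distrib trace_monomial_simps sum_kronecker)
qed

section \<open>The creation operators on combinations\<close>

text \<open>
  \<open>K = A X\<close> for the matrix \<open>A\<close> of operators \<open>F \<mapsto> Y\<^bsub>rs\<^esub> F - \<partial>F / \<partial>Y\<^bsub>rs\<^esub>\<close>. The map \<open>e\<close> says which
  entry of \<open>A\<close> stands at a position, so that \<open>e = Pair\<close> describes \<open>A\<close> and
  \<open>e = (\<lambda>i l. (l, i))\<close> describes \<open>A\<^sup>T\<close>. The witness \<open>P\<close> collects the partial derivatives.
\<close>

definition raised ::
  "nat \<Rightarrow> nat \<Rightarrow> (nat \<Rightarrow> nat \<Rightarrow> nat \<times> nat) \<Rightarrow> matrix_fun \<Rightarrow> matrix_fun \<Rightarrow> bool" where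
  "raised N M e X K \<longleftrightarrow>
     (\<exists>P. (\<forall>i<M. \<forall>l<N. \<forall>j<q. has_partial (e i l) (\<lambda>Y. X Y l j) (P i l j)) \<and>
          (\<forall>Y. \<forall>i<M. \<forall>j<q. K Y i j = (\<Sum>l<N. Y (e i l) * X Y l j - P i l j Y)))"

lemma raised_unique:
  assumes "raised N M e X K" "raised N M e X' K'"
    and "\<And>Y l j. l < N \<Longrightarrow> j < q \<Longrightarrow> X Y l j = X' Y l j"
    and "i < M" "j < q"
  shows "K Y i j = K' Y i j"
proof -
  obtain P where P: "\<forall>i<M. \<forall>l<N. \<forall>j<q. has_partial (e i l) (\<lambda>Y. X Y l j) (P i l j)"
    "\<forall>Y. \<forall>i<M. \<forall>j<q. K Y i j = (\<Sum>l<N. Y (e i l) * X Y l j - P i l j Y)"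
    using assms(1) unfolding raised_def by blast
  obtain P' where P': "\<forall>i<M. \<forall>l<N. \<forall>j<q. has_partial (e i l) (\<lambda>Y. X' Y l j) (P' i l j)"
    "\<forall>Y. \<forall>i<M. \<forall>j<q. K' Y i j = (\<Sum>l<N. Y (e i l) * X' Y l j - P' i l j Y)"
    using assms(2) unfolding raised_def by blast
  have "P i l j = P' i l j" if "l < N" for l
    using P(1)[rule_format, of i l j] P'(1)[rule_format, of i l j] that assms(3-5)
    by (simp add: has_partial_unique)
  then show ?thesis
    using P(2) P'(2) assms(3-5) by simp
qed

lemma raised_add:
  assumes "raised N M e X K" "raised N M e X' K'"
    and "\<And>Y l j. l < N \<Longrightarrow> j < q \<Longrightarrow> X'' Y l j = X Y l j + X' Y l j"
  shows "raised N M e X'' (\<lambda>Y i j. K Y i j + K' Y i j)"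
proof -
  obtain P where P: "\<forall>i<M. \<forall>l<N. \<forall>j<q. has_partial (e i l) (\<lambda>Y. X Y l j) (P i l j)"
    "\<forall>Y. \<forall>i<M. \<forall>j<q. K Y i j = (\<Sum>l<N. Y (e i l) * X Y l j - P i l j Y)"
    using assms(1) unfolding raised_def by blast
  obtain P' where P': "\<forall>i<M. \<forall>l<N. \<forall>j<q. has_partial (e i l) (\<lambda>Y. X' Y l j) (P' i l j)"
    "\<forall>Y. \<forall>i<M. \<forall>j<q. K' Y i j = (\<Sum>l<N. Y (e i l) * X' Y l j - P' i l j Y)"
    using assms(2) unfolding raised_def by blast
  show ?thesis
    unfolding raised_def
    by (rule exI[of _ "\<lambda>i l j Y. P i l j Y + P' i l j Y"])
       (use P P' assms(3) in \<open>auto simp: sum.distrib[symmetric] distrib_left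
         intro!: sum.cong has_partial_add\<close>)
qed

lemma raised_combination:
  assumes "combination N W d X"
    and mono: "\<And>c s m. sum_list s + m < d \<Longrightarrow>
      \<exists>K. combination M W' d' K \<and> raised N M e (\<lambda>Y i j. c * trace_monomial s Y * W m Y i j) K"
  shows "\<exists>K. combination M W' d' K \<and> raised N M e X K"
  using assms(1)
proof (induction rule: combination.induct)
  case (zero X)
  have "raised N M e X (\<lambda>_ _ _. 0)"
    unfolding raised_def
    by (rule exI[of _ "\<lambda>_ _ _ _. 0"]) (use zero in \<open>simp add: has_partial_const\<close>)
  moreover have "combination M W' d' (\<lambda>_ _ _. 0)"
    by (rule combination.zero) simp
  ultimately show ?case by blast
next
  case (step X s m X' c)
  from step.IH obtain K where K: "combination M W' d' K" "raised N M e X K"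
    by blast
  from mono[OF step.hyps(2)] obtain K' where K': "combination M W' d' K'"
    "raised N M e (\<lambda>Y i j. c * trace_monomial s Y * W m Y i j) K'"
    by blast
  have "raised N M e X' (\<lambda>Y i j. K' Y i j + K Y i j)"
    by (rule raised_add[OF K'(2) K(2) step.hyps(3)])
  then show ?case
    using combination_add[OF K'(1) K(1)] by blast
qed

text \<open>
  The derivative falls either on the trace factors, where it leaves their gradient multiplied by
  \<open>G\<^sup>m\<close> (this is \<open>K1\<close>), or on \<open>G\<^sup>m\<close>, where it leaves the divergence (this is \<open>K2\<close>). Keeping
  the leading term separate serves both as the induction step on leading terms, with \<open>s = []\<close>,
  and as the bound on the lower order terms.
\<close>

lemma raised_gram_pow_monomial:
  "\<exists>K. combination p obs_gram_pow (sum_list s + m) K \<and>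
     raised q p Pair (\<lambda>Y i j. c * trace_monomial s Y * gram_pow m Y i j)
       (\<lambda>Y i j. c * trace_monomial s Y * obs_gram_pow m Y i j + K Y i j)"
proof -
  obtain D where D: "combination p obs_gram_pow (sum_list s) D"
    "\<And>r t. r < p \<Longrightarrow> t < q \<Longrightarrow> has_partial (r, t) (trace_monomial s) (\<lambda>Y. D Y r t)"
    using trace_monomial_gradient by blast
  define K1 where "K1 = (\<lambda>Y i j. - c * trace_monomial [] Y * (\<Sum>l<q. D Y i l * gram_pow m Y l j))"
  define K2 where "K2 = (\<lambda>Y i j. - c * trace_monomial s Y * (\<Sum>l<q. d_gram_pow m (i, l) Y l j))"
  have "combination p obs_gram_pow (sum_list s + m) K1"
    unfolding K1_def
    using combination_scale[OF combination_mult_gram_pow[OF D(1) obs_gram_pow_mult, of m], of "[]" "- c"]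
    by simp
  moreover have "combination p obs_gram_pow (sum_list s + m) K2"
    unfolding K2_def by (rule combination_scale[OF gram_pow_divergence])
  ultimately have "combination p obs_gram_pow (sum_list s + m) (\<lambda>Y i j. K1 Y i j + K2 Y i j)"
    by (rule combination_add)
  moreover have "raised q p Pair (\<lambda>Y i j. c * trace_monomial s Y * gram_pow m Y i j)
       (\<lambda>Y i j. c * trace_monomial s Y * obs_gram_pow m Y i j + (K1 Y i j + K2 Y i j))"
    unfolding raised_def
  proof (intro exI conjI allI impI)
    fix i l j
    assume "i < p" "l < q" "j < q"
    then show "has_partial (i, l) (\<lambda>Y. c * trace_monomial s Y * gram_pow m Y l j)
      ((\<lambda>i l j Y. (0 * trace_monomial s Y + c * D Y i l) * gram_pow m Y l j
        + c * trace_monomial s Y * d_gram_pow m (i, l) Y l j) i l j)"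
      by (intro has_partial_mult has_partial_const D(2) has_partial_gram_pow) auto
  next
    fix Y i j
    show "c * trace_monomial s Y * obs_gram_pow m Y i j + (K1 Y i j + K2 Y i j) =
      (\<Sum>l<q. Y (i, l) * (c * trace_monomial s Y * gram_pow m Y l j)
        - (\<lambda>i l j Y. (0 * trace_monomial s Y + c * D Y i l) * gram_pow m Y l j
            + c * trace_monomial s Y * d_gram_pow m (i, l) Y l j) i l j Y)"
      by (simp add: K1_def K2_def obs_gram_pow_def trace_monomial_simps sum_subtractf sum.distrib
          sum_distrib_left sum_negf algebra_simps)
  qed
  ultimately show ?thesis by blast
qed

text \<open>
  The counterpart for \<open>A\<^sup>T\<close>. The product of a gradient, which is built from matrices
  \<open>Y G\<^sup>a\<close>, with \<open>Y G\<^sup>m\<close> gains one exponent by \<open>obs_gram_pow_inner\<close>; this accounts for the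
  successor in the bound.
\<close>

lemma raised_obs_gram_pow_monomial:
  "\<exists>K. combination q gram_pow (Suc (sum_list s + m)) K \<and>
     raised p q (\<lambda>i l. (l, i)) (\<lambda>Y i j. c * trace_monomial s Y * obs_gram_pow m Y i j)
       (\<lambda>Y i j. c * trace_monomial s Y * gram_pow (Suc m) Y i j + K Y i j)"
proof -
  obtain D where D: "combination p obs_gram_pow (sum_list s) D"
    "\<And>r t. r < p \<Longrightarrow> t < q \<Longrightarrow> has_partial (r, t) (trace_monomial s) (\<lambda>Y. D Y r t)"
    using trace_monomial_gradient by blast
  define K1 where "K1 = (\<lambda>Y i j. - c * trace_monomial [] Y * (\<Sum>l<p. D Y l i * obs_gram_pow m Y l j))"
  define K2 where "K2 = (\<lambda>Y i j. - c * trace_monomial s Y * (\<Sum>l<p. d_obs_gram_pow m (l, i) Y l j))"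
  have "combination q gram_pow (Suc (sum_list s + m)) K1"
    unfolding K1_def
    using combination_scale[OF combination_inner_obs_gram_pow[OF D(1), of m], of "[]" "- c"]
    by simp
  moreover have "combination q gram_pow (Suc (sum_list s + m)) K2"
    unfolding K2_def using combination_scale[OF obs_gram_pow_divergence, where s = s and c = "- c"] by simp
  ultimately have "combination q gram_pow (Suc (sum_list s + m)) (\<lambda>Y i j. K1 Y i j + K2 Y i j)"
    by (rule combination_add)
  moreover have "raised p q (\<lambda>i l. (l, i)) (\<lambda>Y i j. c * trace_monomial s Y * obs_gram_pow m Y i j)
       (\<lambda>Y i j. c * trace_monomial s Y * gram_pow (Suc m) Y i j + (K1 Y i j + K2 Y i j))"
    unfolding raised_def
  proof (intro exI conjI allI impI)
    fix i l j
    assume "i < q" "l < p" "j < q"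
    then show "has_partial (l, i) (\<lambda>Y. c * trace_monomial s Y * obs_gram_pow m Y l j)
      ((\<lambda>i l j Y. (0 * trace_monomial s Y + c * D Y l i) * obs_gram_pow m Y l j
        + c * trace_monomial s Y * d_obs_gram_pow m (l, i) Y l j) i l j)"
      by (intro has_partial_mult has_partial_const D(2) has_partial_obs_gram_pow) auto
  next
    fix Y i j
    assume "i < q" "j < q"
    then show "c * trace_monomial s Y * gram_pow (Suc m) Y i j + (K1 Y i j + K2 Y i j) =
      (\<Sum>l<p. Y (l, i) * (c * trace_monomial s Y * obs_gram_pow m Y l j)
        - (\<lambda>i l j Y. (0 * trace_monomial s Y + c * D Y l i) * obs_gram_pow m Y l j
            + c * trace_monomial s Y * d_obs_gram_pow m (l, i) Y l j) i l j Y)"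
      by (simp add: K1_def K2_def obs_mult_obs_gram_pow[symmetric] trace_monomial_simps sum_subtractf
          sum.distrib sum_distrib_left sum_negf algebra_simps)
  qed
  ultimately show ?thesis by blast
qed

lemma raised_gram_pow_combination:
  assumes "combination q gram_pow d X"
  shows "\<exists>K. combination p obs_gram_pow d K \<and> raised q p Pair X K"
  using assms
proof (rule raised_combination)
  fix c s m
  assume *: "sum_list s + m < d"
  obtain K where K: "combination p obs_gram_pow (sum_list s + m) K"
     "raised q p Pair (\<lambda>Y i j. c * trace_monomial s Y * gram_pow m Y i j)
       (\<lambda>Y i j. c * trace_monomial s Y * obs_gram_pow m Y i j + K Y i j)"
    using raised_gram_pow_monomial by blast
  have "combination p obs_gram_pow d
      (\<lambda>Y i j. c * trace_monomial s Y * obs_gram_pow m Y i j + K Y i j)"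
    using * by (intro combination_add combination_term combination_mono[OF K(1)]) auto
  then show "\<exists>K. combination p obs_gram_pow d K \<and>
      raised q p Pair (\<lambda>Y i j. c * trace_monomial s Y * gram_pow m Y i j) K"
    using K(2) by blast
qed

lemma raised_obs_gram_pow_combination:
  assumes "combination p obs_gram_pow d X"
  shows "\<exists>K. combination q gram_pow (Suc d) K \<and> raised p q (\<lambda>i l. (l, i)) X K"
  using assms
proof (rule raised_combination)
  fix c s m
  assume *: "sum_list s + m < d"
  obtain K where K: "combination q gram_pow (Suc (sum_list s + m)) K"
     "raised p q (\<lambda>i l. (l, i)) (\<lambda>Y i j. c * trace_monomial s Y * obs_gram_pow m Y i j)
       (\<lambda>Y i j. c * trace_monomial s Y * gram_pow (Suc m) Y i j + K Y i j)"
    using raised_obs_gram_pow_monomial by blast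
  have "combination q gram_pow (Suc d)
      (\<lambda>Y i j. c * trace_monomial s Y * gram_pow (Suc m) Y i j + K Y i j)"
    using * by (intro combination_add combination_term combination_mono[OF K(1)]) auto
  then show "\<exists>K. combination q gram_pow (Suc d) K \<and>
      raised p q (\<lambda>i l. (l, i)) (\<lambda>Y i j. c * trace_monomial s Y * obs_gram_pow m Y i j) K"
    using K(2) by blast
qed

section \<open>Sums over walks\<close>

definition hermite_product :: "(nat \<times> nat) multiset \<Rightarrow> entries \<Rightarrow> real" where
  "hermite_product w Y = (\<Prod>rs\<in>{..<p} \<times> {..<q}. poly (hermite (count w rs)) (Y rs))"

text \<open>
  The operator at \<open>(r, s)\<close> adds \<open>(r, s)\<close> to the multiset: only the factor at that position depends
  on \<open>Y\<^bsub>rs\<^esub>\<close>, and the recurrence \<open>hermite_Suc\<close> applies to it.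
\<close>

lemma has_partial_hermite_product:
  assumes "r < p" "s < q"
  shows "has_partial (r, s) (hermite_product w)
    (\<lambda>Y. Y (r, s) * hermite_product w Y - hermite_product (add_mset (r, s) w) Y)"
  unfolding has_partial_def
proof
  fix Y :: entries
  let ?I = "{..<p} \<times> {..<q}" and ?H = "hermite (count w (r, s))"
  define R where "R = (\<Prod>e\<in>?I - {(r, s)}. poly (hermite (count w e)) (Y e))"
  have split: "hermite_product v Z = poly (hermite (count v (r, s))) (Z (r, s)) *
      (\<Prod>e\<in>?I - {(r, s)}. poly (hermite (count v e)) (Z e))" for v Z
    unfolding hermite_product_def using assms by (intro prod.remove) auto
  have rest: "(\<Prod>e\<in>?I - {(r, s)}. poly (hermite (count (add_mset (r, s) w) e)) (Y e)) = R"
    unfolding R_def by (rule prod.cong) auto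
  have add: "hermite_product (add_mset (r, s) w) Y = poly (hermite (Suc (count w (r, s)))) (Y (r, s)) * R"
    by (simp only: split rest) simp
  have "hermite_product w (Y((r, s) := Y (r, s) + x)) = poly ?H (Y (r, s) + x) * R" for x
    by (simp add: split R_def)
  moreover have "Y (r, s) * hermite_product w Y - hermite_product (add_mset (r, s) w) Y
      = poly (pderiv ?H) (Y (r, s)) * R"
    unfolding add by (simp add: split R_def hermite_Suc algebra_simps)
  moreover have "((\<lambda>x. poly ?H (Y (r, s) + x) * R) has_real_derivative
      poly (pderiv ?H) (Y (r, s)) * R) (at 0)"
  proof (rule DERIV_cmult_right)
    show "((\<lambda>x. poly ?H (Y (r, s) + x)) has_real_derivative poly (pderiv ?H) (Y (r, s))) (at 0)"
      using DERIV_shift[of "poly ?H" "poly (pderiv ?H) (Y (r, s))" 0 "Y (r, s)"] poly_DERIV[of ?H "Y (r, s)"]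
      by (simp add: add.commute)
  qed
  ultimately show "((\<lambda>x. hermite_product w (Y((r, s) := Y (r, s) + x))) has_real_derivative
      Y (r, s) * hermite_product w Y - hermite_product (add_mset (r, s) w) Y) (at 0)"
    by simp
qed

definition walk_edges :: "nat \<Rightarrow> (nat \<Rightarrow> nat) \<Rightarrow> (nat \<Rightarrow> nat) \<Rightarrow> (nat \<times> nat) multiset" where
  "walk_edges n i j = (\<Sum>t<n. {#(i t, j t), (i t, j (Suc t))#})"

text \<open>
  The walk visits the columns \<open>j 0, ..., j n\<close> and passes through the row \<open>i t\<close> between \<open>j t\<close> and
  \<open>j (Suc t)\<close>. It starts at \<open>a\<close> and ends at \<open>b\<close>. The final column is inserted by the update
  \<open>j(n := b)\<close>, so that the summation ranges over the same index functions as in \<^const>\<open>U\<close>.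
\<close>

definition walk_sum :: "nat \<Rightarrow> ((nat \<times> nat) multiset \<Rightarrow> real) \<Rightarrow> nat \<Rightarrow> nat \<Rightarrow> real" where
  "walk_sum n f b a = (\<Sum>i\<in>{..<n} \<rightarrow>\<^sub>E {..<p}. \<Sum>j\<in>{..<n} \<rightarrow>\<^sub>E {..<q}.
     if (j(n := b)) 0 = a then f (walk_edges n i (j(n := b))) else 0)"

lemma sum_PiE_lessThan_Suc:
  fixes f :: "(nat \<Rightarrow> nat) \<Rightarrow> real"
  shows "(\<Sum>g\<in>{..<Suc n} \<rightarrow>\<^sub>E S. f g) = (\<Sum>x\<in>S. \<Sum>g\<in>{..<n} \<rightarrow>\<^sub>E S. f (g(n := x)))"
proof -
  have "(\<Sum>g\<in>{..<Suc n} \<rightarrow>\<^sub>E S. f g) = (\<Sum>(x, g)\<in>S \<times> ({..<n} \<rightarrow>\<^sub>E S). f (g(n := x)))"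
    unfolding lessThan_Suc PiE_insert_eq
    using inj_combinator[of n "{..<n}" "\<lambda>_. S"]
    by (subst sum.reindex) (auto simp: case_prod_unfold)
  then show ?thesis
    by (simp add: sum.cartesian_product)
qed

lemma walk_edges_cong:
  "(\<And>t. t < n \<Longrightarrow> i t = i' t) \<Longrightarrow> (\<And>t. t \<le> n \<Longrightarrow> j t = j' t) \<Longrightarrow> walk_edges n i j = walk_edges n i' j'"
  by (auto simp: walk_edges_def intro!: sum.cong)

lemma walk_edges_Suc:
  "walk_edges (Suc n) (i(n := x)) (j(n := y, Suc n := b))
    = add_mset (x, b) (add_mset (x, y) (walk_edges n i (j(n := y))))"
proof -
  have "walk_edges n (i(n := x)) (j(n := y, Suc n := b)) = walk_edges n i (j(n := y))"
    by (rule walk_edges_cong) auto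
  then show ?thesis by (simp add: walk_edges_def)
qed

lemma walk_sum_0: "walk_sum 0 f b a = (if b = a then f {#} else 0)"
  by (simp add: walk_sum_def walk_edges_def)

text \<open>
  Removing the last two edges, which meet in the row \<open>x\<close>, leaves a walk ending in the column
  \<open>y\<close>.
\<close>

lemma walk_sum_Suc:
  "walk_sum (Suc n) f b a
    = (\<Sum>x<p. \<Sum>y<q. walk_sum n (\<lambda>w. f (add_mset (x, b) (add_mset (x, y) w))) y a)"
proof -
  have "walk_sum (Suc n) f b a
    = (\<Sum>x<p. \<Sum>i\<in>{..<n} \<rightarrow>\<^sub>E {..<p}. \<Sum>y<q. \<Sum>j\<in>{..<n} \<rightarrow>\<^sub>E {..<q}.
        if (j(n := y)) 0 = a then f (add_mset (x, b) (add_mset (x, y) (walk_edges n i (j(n := y))))) else 0)"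
    unfolding walk_sum_def sum_PiE_lessThan_Suc walk_edges_Suc
    by (intro sum.cong refl if_cong) auto
  also have "\<dots> = (\<Sum>x<p. \<Sum>y<q. walk_sum n (\<lambda>w. f (add_mset (x, b) (add_mset (x, y) w))) y a)"
    unfolding walk_sum_def by (rule sum.cong[OF refl], rule sum.swap)
  finally show ?thesis .
qed

lemma walk_sum_linear:
  "walk_sum n (\<lambda>w. c * f w - g w) b a = c * walk_sum n f b a - walk_sum n g b a"
  unfolding walk_sum_def sum_distrib_left sum_subtractf[symmetric]
  by (intro sum.cong refl) auto

lemma has_partial_walk_sum:
  assumes "\<And>w. has_partial rs (F w) (F' w)"
  shows "has_partial rs (\<lambda>Y. walk_sum n (\<lambda>w. F w Y) b a) (\<lambda>Y. walk_sum n (\<lambda>w. F' w Y) b a)"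
proof -
  have "has_partial rs (\<lambda>Y. if P then F w Y else 0) (\<lambda>Y. if P then F' w Y else 0)" for P w
    using assms by (cases P) (simp_all add: has_partial_const)
  then show ?thesis
    unfolding walk_sum_def by (intro has_partial_sum)
qed

lemma has_partial_walk_sum_hermite:
  assumes "r < p" "s < q"
  shows "has_partial (r, s) (\<lambda>Y. walk_sum n (\<lambda>w. hermite_product (add_mset e w) Y) b a)
      (\<lambda>Y. Y (r, s) * walk_sum n (\<lambda>w. hermite_product (add_mset e w) Y) b a
        - walk_sum n (\<lambda>w. hermite_product (add_mset (r, s) (add_mset e w)) Y) b a)"
    and "has_partial (r, s) (\<lambda>Y. walk_sum n (\<lambda>w. hermite_product w Y) b a)
      (\<lambda>Y. Y (r, s) * walk_sum n (\<lambda>w. hermite_product w Y) b a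
        - walk_sum n (\<lambda>w. hermite_product (add_mset (r, s) w) Y) b a)"
  unfolding walk_sum_linear[symmetric]
  by (intro has_partial_walk_sum has_partial_hermite_product assms)+

text \<open>
  These are the matrices \<open>(A\<^sup>T A)\<^sup>n 1\<close> and \<open>A (A\<^sup>T A)\<^sup>n 1\<close>. The end of the walk is the row index, so
  that the operators act from the left.
\<close>

definition even_walks :: "nat \<Rightarrow> matrix_fun" where
  "even_walks n Y b a = walk_sum n (\<lambda>w. hermite_product w Y) b a"

definition odd_walks :: "nat \<Rightarrow> matrix_fun" where
  "odd_walks n Y x a = (\<Sum>y<q. walk_sum n (\<lambda>w. hermite_product (add_mset (x, y) w) Y) y a)"

lemma raised_even_walks: "raised q p Pair (even_walks n) (odd_walks n)"
  unfolding raised_def even_walks_def odd_walks_def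
  by (rule exI[of _ "\<lambda>x y a Y. Y (x, y) * walk_sum n (\<lambda>w. hermite_product w Y) y a
        - walk_sum n (\<lambda>w. hermite_product (add_mset (x, y) w) Y) y a"])
     (auto intro: has_partial_walk_sum_hermite)

lemma raised_odd_walks: "raised p q (\<lambda>b x. (x, b)) (odd_walks n) (even_walks (Suc n))"
  unfolding raised_def
proof (intro exI conjI allI impI)
  fix b x a
  assume "b < q" "x < p" "a < q"
  then show "has_partial (x, b) (\<lambda>Y. odd_walks n Y x a)
    ((\<lambda>b x a Y. \<Sum>y<q. Y (x, b) * walk_sum n (\<lambda>w. hermite_product (add_mset (x, y) w) Y) y a
        - walk_sum n (\<lambda>w. hermite_product (add_mset (x, b) (add_mset (x, y) w)) Y) y a) b x a)"
    unfolding odd_walks_def by (intro has_partial_sum has_partial_walk_sum_hermite)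
qed (simp add: even_walks_def odd_walks_def walk_sum_Suc sum_subtractf sum_distrib_left)

text \<open>
  Extending the walk by two edges: \<open>A\<close> turns the leading term \<open>G\<^sup>n\<close> into \<open>Y G\<^sup>n\<close>, with
  error \<open>K1\<close>, and the old error \<open>E\<close> into \<open>K2\<close>; then \<open>A\<^sup>T\<close> turns \<open>Y G\<^sup>n\<close> into \<open>G\<^bsup>n+1\<^esup>\<close>, with error
  \<open>K3\<close>, and \<open>K1 + K2\<close> into \<open>K4\<close>.
\<close>

lemma even_walks_expansion:
  "\<exists>E. combination q gram_pow n E \<and>
     (\<forall>Y. \<forall>b<q. \<forall>a<q. even_walks n Y b a = gram_pow n Y b a + E Y b a)"
proof (induction n)
  case 0
  have "combination q gram_pow 0 (\<lambda>_ _ _. 0)"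
    by (rule combination.zero) simp
  moreover have "even_walks 0 Y b a = gram_pow 0 Y b a + 0" for Y b a
    by (simp add: even_walks_def walk_sum_0 hermite_product_def hermite_0)
  ultimately show ?case by blast
next
  case (Suc n)
  then obtain E where E: "combination q gram_pow n E"
    "\<And>Y b a. b < q \<Longrightarrow> a < q \<Longrightarrow> even_walks n Y b a = gram_pow n Y b a + E Y b a"
    by blast
  obtain K1 where K1: "combination p obs_gram_pow n K1"
    "raised q p Pair (gram_pow n) (\<lambda>Y i j. obs_gram_pow n Y i j + K1 Y i j)"
    using raised_gram_pow_monomial[of "[]" n 1] by (auto simp: trace_monomial_simps)
  obtain K2 where K2: "combination p obs_gram_pow n K2" "raised q p Pair E K2"
    using raised_gram_pow_combination[OF E(1)] by blast
  define O' where "O' = (\<lambda>Y i j. K1 Y i j + K2 Y i j)"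
  have O': "combination p obs_gram_pow n O'"
    unfolding O'_def by (rule combination_add[OF K1(1) K2(1)])
  have odd: "odd_walks n Y x a = obs_gram_pow n Y x a + O' Y x a" if "x < p" "a < q" for Y x a
    using raised_unique[OF raised_even_walks raised_add[OF K1(2) K2(2) E(2)] _ that, of n Y]
    by (simp add: O'_def)
  obtain K3 where K3: "combination q gram_pow (Suc n) K3"
    "raised p q (\<lambda>i l. (l, i)) (obs_gram_pow n) (\<lambda>Y i j. gram_pow (Suc n) Y i j + K3 Y i j)"
    using raised_obs_gram_pow_monomial[of "[]" n 1] by (auto simp: trace_monomial_simps)
  obtain K4 where K4: "combination q gram_pow (Suc n) K4" "raised p q (\<lambda>i l. (l, i)) O' K4"
    using raised_obs_gram_pow_combination[OF O'] by blast
  have "even_walks (Suc n) Y b a = gram_pow (Suc n) Y b a + (K3 Y b a + K4 Y b a)"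
    if "b < q" "a < q" for Y b a
    using raised_unique[OF raised_odd_walks raised_add[OF K3(2) K4(2) odd] _ that, of n Y]
    by simp
  then show ?case
    using combination_add[OF K3(1) K4(1)] by blast
qed

section \<open>Traces of combinations\<close>

lemma trace_monomial_sort:
  "trace_monomial s Y
    = real q ^ length (filter (\<lambda>m. m = 0) s) * trace_monomial (sort (filter (\<lambda>m. m > 0) s)) Y"
proof -
  have "mset (sort (filter (\<lambda>m. m > 0) s)) = mset (filter (\<lambda>m. m > 0) s)"
    by simp
  then have "trace_monomial (sort (filter (\<lambda>m. m > 0) s)) Y = trace_monomial (filter (\<lambda>m. m > 0) s) Y"
    unfolding trace_monomial_def by (metis mset_map prod_mset_prod_list)
  moreover have "trace_monomial s Y
    = real q ^ length (filter (\<lambda>m. m = 0) s) * trace_monomial (filter (\<lambda>m. m > 0) s) Y"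
    by (induction s) (auto simp: trace_monomial_simps gram_trace_def)
  ultimately show ?thesis by simp
qed

text \<open>
  Taking the trace turns the matrix factor \<open>G\<^sup>m\<close> into one more trace, so the term with exponents
  \<open>s\<close> and \<open>m\<close> becomes a multiple of the monomial for the sorted list \<open>u\<close> of the positive ones
  among \<open>m # s\<close>. The zero exponents go into the coefficient \<open>C\<close>. If \<open>u\<close> is empty, the term
  contributes to the constant.
\<close>

lemma trace_combination:
  assumes "combination q gram_pow k E"
  shows "\<exists>\<alpha>\<^sub>0 \<alpha>. \<forall>Y. (\<Sum>a<q. E Y a a)
    = \<alpha>\<^sub>0 + (\<Sum>l = 1..k - 1. \<Sum>s\<in>nondec_seqs l. \<alpha> s * trace_monomial s Y)"
  using assms
proof (induction rule: combination.induct)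
  case (zero X)
  then show ?case
    by (intro exI[of _ 0] exI[of _ "\<lambda>_. 0"]) simp
next
  case (step X s m X' c)
  then obtain \<alpha>\<^sub>0 \<alpha> where IH: "\<And>Y. (\<Sum>a<q. X Y a a)
    = \<alpha>\<^sub>0 + (\<Sum>l = 1..k - 1. \<Sum>s\<in>nondec_seqs l. \<alpha> s * trace_monomial s Y)"
    by blast
  \<comment> \<open>\<open>m\<close> joins the list because the trace of \<open>G\<^sup>m\<close> is a further factor\<close>
  define u where "u = sort (filter (\<lambda>m. m > 0) (m # s))"
  define C where "C = c * real q ^ length (filter (\<lambda>m. m = 0) (m # s))"
  have X': "(\<Sum>a<q. X' Y a a) = C * trace_monomial u Y + (\<Sum>a<q. X Y a a)" for Y
  proof -
    have "(\<Sum>a<q. X' Y a a) = c * trace_monomial (m # s) Y + (\<Sum>a<q. X Y a a)"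
      using step.hyps(3)
      by (simp add: sum.distrib sum_distrib_left gram_trace_def trace_monomial_simps algebra_simps)
    then show ?thesis
      using trace_monomial_sort[of "m # s" Y] by (simp only: u_def C_def mult.assoc)
  qed
  have "sum_list (filter (\<lambda>m. m > 0) v) = sum_list v" for v :: "nat list"
    by (induction v) auto
  then have sum_u: "sum_list u = sum_list s + m"
    unfolding u_def by (metis add.commute sum_list.Cons mset_sort sum_mset_sum_list)
  have u: "u \<in> nondec_seqs (sum_list u)"
    by (auto simp: u_def nondec_seqs_def)
  show ?case
  proof (cases "sum_list u = 0")
    case True
    then have "u = []"
      using u by (cases u) (auto simp: nondec_seqs_def)
    then show ?thesis
      by (intro exI[of _ "\<alpha>\<^sub>0 + C"] exI[of _ \<alpha>]) (simp add: X' IH trace_monomial_simps)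
  next
    case False
    then have l: "sum_list u \<in> {1..k - 1}"
      using step.hyps(2) sum_u unfolding atLeastAtMost_iff by linarith
    have "(\<Sum>l = 1..k - 1. \<Sum>s\<in>nondec_seqs l. (if s = u then C else 0) * trace_monomial s Y)
      = (\<Sum>l = 1..k - 1. if l = sum_list u then C * trace_monomial u Y else 0)" for Y
    proof (rule sum.cong[OF refl])
      fix l
      have "(\<Sum>s\<in>nondec_seqs l. (if s = u then C else 0) * trace_monomial s Y)
        = (\<Sum>s\<in>nondec_seqs l. if s = u then C * trace_monomial u Y else 0)"
        by (intro sum.cong) auto
      moreover have "u \<in> nondec_seqs l \<longleftrightarrow> l = sum_list u"
        using u by (auto simp: nondec_seqs_def)
      ultimately show "(\<Sum>s\<in>nondec_seqs l. (if s = u then C else 0) * trace_monomial s Y)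
        = (if l = sum_list u then C * trace_monomial u Y else 0)"
        using finite_nondec_seqs by simp
    qed
    then have "(\<Sum>l = 1..k - 1. \<Sum>s\<in>nondec_seqs l. (if s = u then C else 0) * trace_monomial s Y)
      = C * trace_monomial u Y" for Y
      using l by simp
    then show ?thesis
      by (intro exI[of _ \<alpha>\<^sub>0] exI[of _ "\<lambda>s. (if s = u then C else 0) + \<alpha> s"])
         (simp add: X' IH distrib_right sum.distrib)
  qed
qed

section \<open>Closed walks\<close>

lemma count_walk_edges:
  assumes "k \<ge> 1"
  shows "count (walk_edges k i (j(k := j 0))) (r, s) = pair_count k i j r s"
proof -
  have "count (walk_edges k i (j(k := j 0))) (r, s)
    = (\<Sum>t<k. (if (i t, j t) = (r, s) then 1 else 0) + (if (i t, j (Suc t mod k)) = (r, s) then 1 else 0))"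
    unfolding walk_edges_def count_sum
  proof (rule sum.cong[OF refl])
    fix t
    assume "t \<in> {..<k}"
    then have "(j(k := j 0)) t = j t" "(j(k := j 0)) (Suc t) = j (Suc t mod k)"
      using assms by (auto simp: mod_Suc)
    then show "count {#(i t, (j(k := j 0)) t), (i t, (j(k := j 0)) (Suc t))#} (r, s)
      = (if (i t, j t) = (r, s) then 1 else 0) + (if (i t, j (Suc t mod k)) = (r, s) then 1 else 0)"
      by auto
  qed
  also have "\<dots> = pair_count k i j r s"
    by (simp add: pair_count_def sum.distrib sum.If_cases Int_def)
  finally show ?thesis .
qed

text \<open>
  For \<open>k \<ge> 1\<close> the diagonal condition \<open>j 0 = a\<close> determines the inserted final column, and the update
  \<open>j(k := j 0)\<close> reproduces the cyclic successor \<open>Suc t mod k\<close>.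
\<close>

lemma sum_closed_walks:
  assumes "k \<ge> 1"
  shows "(\<Sum>a<q. even_walks k Y a a) = (\<Sum>i\<in>{..<k} \<rightarrow>\<^sub>E {..<p}. \<Sum>j\<in>{..<k} \<rightarrow>\<^sub>E {..<q}.
    \<Prod>r<p. \<Prod>s<q. poly (hermite (pair_count k i j r s)) (Y (r, s)))"
proof -
  let ?f = "\<lambda>i j a. hermite_product (walk_edges k i (j(k := a))) Y"
  have "(\<Sum>a<q. even_walks k Y a a) = (\<Sum>a<q. \<Sum>i\<in>{..<k} \<rightarrow>\<^sub>E {..<p}. \<Sum>j\<in>{..<k} \<rightarrow>\<^sub>E {..<q}.
      if j 0 = a then ?f i j a else 0)"
    using assms by (simp add: even_walks_def walk_sum_def)
  also have "\<dots> = (\<Sum>i\<in>{..<k} \<rightarrow>\<^sub>E {..<p}. \<Sum>j\<in>{..<k} \<rightarrow>\<^sub>E {..<q}. \<Sum>a<q.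
      if j 0 = a then ?f i j a else 0)"
    by (subst sum.swap) (rule sum.cong[OF refl], rule sum.swap)
  also have "\<dots> = (\<Sum>i\<in>{..<k} \<rightarrow>\<^sub>E {..<p}. \<Sum>j\<in>{..<k} \<rightarrow>\<^sub>E {..<q}. ?f i j (j 0))"
  proof (intro sum.cong refl)
    fix i j
    assume "j \<in> {..<k} \<rightarrow>\<^sub>E {..<q}"
    from PiE_mem[OF this, of 0] have "j 0 < q" using assms by simp
    then show "(\<Sum>a<q. if j 0 = a then ?f i j a else 0) = ?f i j (j 0)"
      by simp
  qed
  moreover have "?f i j (j 0) = (\<Prod>r<p. \<Prod>s<q. poly (hermite (pair_count k i j r s)) (Y (r, s)))" for i j
    unfolding hermite_product_def prod.cartesian_product
    by (intro prod.cong refl) (auto simp only: count_walk_edges[OF assms] split: prod.split)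
  ultimately show ?thesis by simp
qed

lemma gram_pow_eq_pow_mat:
  assumes "A \<in> carrier_mat p q" "i < q" "j < q"
  shows "((transpose_mat A * A) ^\<^sub>m m) $$ (i, j) = gram_pow m (\<lambda>rs. A $$ rs) i j"
  using assms(2,3)
proof (induction m arbitrary: j)
  case 0
  then show ?case using assms(1) by simp
next
  case (Suc m)
  have gram: "(transpose_mat A * A) $$ (b, j) = gram (\<lambda>rs. A $$ rs) b j" if "b < q" for b
    using assms(1) Suc.prems that by (simp add: gram_def scalar_prod_def atLeast0LessThan)
  have entry: "(P * B) $$ (i, j) = (\<Sum>b<q. P $$ (i, b) * B $$ (b, j))"
    if "P \<in> carrier_mat q q" "B \<in> carrier_mat q q" for P B :: "real mat"
    using that Suc.prems by (simp add: scalar_prod_def atLeast0LessThan)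
  have "((transpose_mat A * A) ^\<^sub>m Suc m) $$ (i, j)
      = (\<Sum>b<q. ((transpose_mat A * A) ^\<^sub>m m) $$ (i, b) * (transpose_mat A * A) $$ (b, j))"
    using assms(1) by (simp add: entry)
  also have "\<dots> = (\<Sum>b<q. gram_pow m (\<lambda>rs. A $$ rs) i b * gram (\<lambda>rs. A $$ rs) b j)"
    using Suc.IH[OF Suc.prems(1)] gram by simp
  finally show ?case
    by (simp only: gram_pow.simps)
qed

lemma gram_trace_eq_mat_trace:
  assumes "A \<in> carrier_mat p q"
  shows "gram_trace m (\<lambda>rs. A $$ rs) = mat_trace ((transpose_mat A * A) ^\<^sub>m m)"
proof -
  have "(transpose_mat A * A) ^\<^sub>m m \<in> carrier_mat q q"
    using assms by auto
  then show ?thesis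
    using assms by (simp add: gram_trace_def mat_trace_def gram_pow_eq_pow_mat)
qed

end

theorem proposition3p1:
  fixes p q k :: nat
  assumes "q \<ge> 1" and "p \<ge> q" and "k \<ge> 1"
  shows "\<exists>(\<alpha>\<^sub>0 :: real) (\<alpha> :: nat list \<Rightarrow> real). \<forall>Y \<in> carrier_mat p q.
    U k Y = mat_trace ((transpose_mat Y * Y) ^\<^sub>m k) + \<alpha>\<^sub>0
      + (\<Sum>l = 1..k - 1. \<Sum>s \<in> nondec_seqs l.
           \<alpha> s * (\<Prod>m\<leftarrow>s. mat_trace ((transpose_mat Y * Y) ^\<^sub>m m)))"
proof -
  obtain E where E: "combination p q q (gram_pow p q) k E"
    "\<And>Y b a. b < q \<Longrightarrow> a < q \<Longrightarrow> even_walks p q k Y b a = gram_pow p q k Y b a + E Y b a"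
    using even_walks_expansion[where p = p and q = q and n = k] by blast
  obtain \<alpha>\<^sub>0 \<alpha> where \<alpha>: "\<And>Y. (\<Sum>a<q. E Y a a)
    = \<alpha>\<^sub>0 + (\<Sum>l = 1..k - 1. \<Sum>s\<in>nondec_seqs l. \<alpha> s * trace_monomial p q s Y)"
    using trace_combination[OF E(1)] by blast
  have "U k Y = mat_trace ((transpose_mat Y * Y) ^\<^sub>m k) + \<alpha>\<^sub>0
      + (\<Sum>l = 1..k - 1. \<Sum>s \<in> nondec_seqs l.
           \<alpha> s * (\<Prod>m\<leftarrow>s. mat_trace ((transpose_mat Y * Y) ^\<^sub>m m)))"
    if Y: "Y \<in> carrier_mat p q" for Y
  proof -
    let ?Y = "\<lambda>rs. Y $$ rs"
    have "U k Y = (\<Sum>a<q. even_walks p q k ?Y a a)"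
      using Y sum_closed_walks[OF assms(3), of p q ?Y] by (simp add: U_def)
    also have "\<dots> = gram_trace p q k ?Y + (\<Sum>a<q. E ?Y a a)"
      using E(2) by (simp add: gram_trace_def sum.distrib)
    finally show ?thesis
      by (simp add: \<alpha> trace_monomial_def gram_trace_eq_mat_trace[OF Y])
  qed
  then show ?thesis by blast
qed

end
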